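(* Let $M$ be a loopless matroid on a finite set $E$, and let $g(M)$ be the maximal $k$ such that there exists a Gallai coloring of $M$ using exactly $k$ colors. Then $g(M) = \operatorname{rank}(M)$.
   Context: A matroid is loopless if it has no circuit of size $1$. For a positive integer $k$, write $[k]=\{1,\dots,k\}$. A Gallai coloring of a matroid $M$ on a finite set $E$ (with colors in a set $C$, e.g. $C=[k]$) is a function $\varepsilon: E\to C$ such that for every circuit $X$ of $M$, $|\{\varepsilon(e) : e\in X\}| < |X|$ (no circuit is rainbow). It uses exactly $k$ colors if $|\varepsilon(E)|=k$. (If $E=\varnothing$, then $g(M)=0$.) *)

theory Defs
  imports Main "HOL-Library.FuncSet"
begin

locale matroid =
  fixes E :: "'a set" and indep :: "'a set \<Rightarrow> bool"
  assumes finite_ground: "finite E"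
    and indep_subset_ground: "indep X \<Longrightarrow> X \<subseteq> E"
    and indep_empty: "indep {}"
    and indep_subset: "\<lbrakk>indep X; Y \<subseteq> X\<rbrakk> \<Longrightarrow> indep Y"
    and augmentation:
      "\<lbrakk>indep X; indep Y; card X < card Y\<rbrakk> \<Longrightarrow> \<exists>y\<in>Y - X. indep (insert y X)"
begin

definition circuit :: "'a set \<Rightarrow> bool" where
  "circuit X \<longleftrightarrow> X \<subseteq> E \<and> \<not> indep X \<and> (\<forall>Y. Y \<subset> X \<longrightarrow> indep Y)"

definition loopless :: bool where
  "loopless \<longleftrightarrow> \<not> (\<exists>X. circuit X \<and> card X = 1)"

definition rank_of :: "'a set \<Rightarrow> nat" where
  "rank_of A = Max {card X | X. X \<subseteq> A \<and> indep X}"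

definition rank :: nat where
  "rank = rank_of E"

text \<open>A coloring is represented by a total function; only its values on \<open>E\<close> matter.\<close>

definition gallai_coloring :: "'c set \<Rightarrow> ('a \<Rightarrow> 'c) \<Rightarrow> bool" where
  "gallai_coloring C \<epsilon> \<longleftrightarrow>
     \<epsilon> \<in> E \<rightarrow> C \<and> (\<forall>X. circuit X \<longrightarrow> card (\<epsilon> ` X) < card X)"

definition uses_exactly :: "nat \<Rightarrow> ('a \<Rightarrow> 'c) \<Rightarrow> bool" where
  "uses_exactly k \<epsilon> \<longleftrightarrow> card (\<epsilon> ` E) = k"

text \<open>
  Colors for a \<open>k\<close>-coloring are taken from \<open>{1..k}\<close>; as colors may be renamed, this is no
  restriction. For \<open>E = {}\<close> the only admissible \<open>k\<close> is \<open>0\<close>. The two lemmas below show that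
  for loopless matroids the maximum is over a finite nonempty set.
\<close>

definition gallai_counts :: "nat set" where
  "gallai_counts =
     {k. \<exists>\<epsilon> :: 'a \<Rightarrow> nat. gallai_coloring {1..k} \<epsilon> \<and> uses_exactly k \<epsilon>}"

definition gallai_number :: nat where
  "gallai_number = Max gallai_counts"

lemma finite_gallai_counts: "finite gallai_counts"
proof (rule finite_subset)
  show "gallai_counts \<subseteq> {..card E}"
    using finite_ground by (auto simp: gallai_counts_def uses_exactly_def card_image_le)
qed simp

lemma gallai_counts_nonempty:
  assumes loopless
  shows "gallai_counts \<noteq> {}"
proof -
  let ?k = "card ((\<lambda>_. 1 :: nat) ` E)"
  have k: "?k = (if E = {} then 0 else 1)" by (simp add: image_constant_conv)
  have "card ((\<lambda>_. 1 :: nat) ` X) < card X" if "circuit X" for X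
  proof -
    have "finite X" "X \<noteq> {}" "card X \<noteq> 1"
      using that assms finite_ground indep_empty
      by (auto simp: circuit_def loopless_def intro: finite_subset)
    then have "card X > 1" by (metis One_nat_def Suc_lessI card_gt_0_iff)
    with \<open>X \<noteq> {}\<close> show ?thesis by (simp add: image_constant_conv)
  qed
  then have "gallai_coloring {1..?k} (\<lambda>_. 1 :: nat)"
    unfolding gallai_coloring_def k by auto
  then have "?k \<in> gallai_counts"
    unfolding gallai_counts_def uses_exactly_def by blast
  then show ?thesis by blast
qed

end

end

(* A transversal of the colors of a Gallai coloring contains no circuit, hence is independent; this
   bounds the number of colors by the rank. Conversely, let b 1, ..., b r be a basis and color e by
   the least i such that e is spanned by b 1, ..., b i. Replacing the b i one after the other by
   elements of color i preserves independence, so every rainbow set is independent. *)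

theory Submission
  imports Defs
begin

context matroid
begin

section \<open>Circuits, rank and bases\<close>

lemma indep_finite: "indep X \<Longrightarrow> finite X"
  using indep_subset_ground finite_ground finite_subset by blast

lemma dependent_contains_circuit:
  assumes "X \<subseteq> E" "\<not> indep X"
  obtains Y where "Y \<subseteq> X" "circuit Y"
proof -
  let ?D = "{Y. Y \<subseteq> X \<and> \<not> indep Y}"
  have "finite ?D"
    using assms(1) finite_ground by (simp add: finite_subset)
  moreover have "?D \<noteq> {}"
    using assms(2) by blast
  ultimately obtain Y where "Y \<in> ?D" and min: "\<forall>Z\<in>?D. Z \<subseteq> Y \<longrightarrow> Y = Z"
    using finite_has_minimal[of ?D] by blast
  then have Y: "Y \<subseteq> X" "\<not> indep Y"
    by auto
  with min have "circuit Y"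
    using assms(1) unfolding circuit_def by blast
  with Y that show thesis by blast
qed

lemma finite_indep_cards: "finite {card X | X. X \<subseteq> A \<and> indep X}"
proof (rule finite_subset)
  show "{card X | X. X \<subseteq> A \<and> indep X} \<subseteq> {..card E}"
    using indep_subset_ground finite_ground by (auto intro: card_mono)
qed simp

lemma card_le_rank: "indep X \<Longrightarrow> card X \<le> rank"
  unfolding rank_def rank_of_def
  using indep_subset_ground by (auto intro!: Max_ge finite_indep_cards)

lemma obtain_basis:
  obtains B where "indep B" "card B = rank"
proof -
  have "rank \<in> {card X | X. X \<subseteq> E \<and> indep X}"
    unfolding rank_def rank_of_def
    using indep_empty by (intro Max_in finite_indep_cards) auto
  with that show thesis by auto
qed

lemma loopless_indep_singleton:
  assumes loopless "e \<in> E"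
  shows "indep {e}"
proof (rule ccontr)
  assume "\<not> indep {e}"
  moreover have "indep Y" if "Y \<subset> {e}" for Y
    using that indep_empty by (metis psubset_eq subset_singletonD)
  ultimately have "circuit {e}"
    using assms(2) by (auto simp: circuit_def)
  with assms(1) show False
    by (auto simp: loopless_def)
qed

section \<open>Upper bound on the number of colors\<close>

lemma rainbow_indep:
  assumes "gallai_coloring C \<epsilon>" "X \<subseteq> E" "inj_on \<epsilon> X"
  shows "indep X"
proof (rule ccontr)
  assume "\<not> indep X"
  then obtain Y where Y: "Y \<subseteq> X" "circuit Y"
    using assms(2) dependent_contains_circuit by blast
  \<comment> \<open>Injectivity passes from \<open>X\<close> to \<open>Y\<close>, so the circuit
    \<open>Y\<close> would be rainbow.\<close>
  then have "card (\<epsilon> ` Y) = card Y"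
    using assms(3) card_image inj_on_subset by blast
  then show False
    using assms(1) Y(2) by (auto simp: gallai_coloring_def)
qed

lemma gallai_colors_le_rank:
  assumes "gallai_coloring C \<epsilon>"
  shows "card (\<epsilon> ` E) \<le> rank"
proof -
  \<comment> \<open>\<open>T\<close> picks one element of each color, so it is rainbow.\<close>
  obtain T where "T \<subseteq> E" "inj_on \<epsilon> T" "\<epsilon> ` E = \<epsilon> ` T"
    by (metis subset_image_inj subset_refl)
  then show ?thesis
    using rainbow_indep[OF assms] card_le_rank card_image by metis
qed

section \<open>Span and the coloring along a flag\<close>

text \<open>For independent \<open>I\<close> and \<open>e\<close> in \<open>E\<close> this is
  membership in the closure of \<open>I\<close>. Elements outside \<open>E\<close> count as spanned
  by every set.\<close>

definition spanned :: "'a set \<Rightarrow> 'a \<Rightarrow> bool" where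
  "spanned I e \<longleftrightarrow> e \<in> I \<or> \<not> indep (insert e I)"

lemma spanned_mono: "spanned I e \<Longrightarrow> I \<subseteq> J \<Longrightarrow> spanned J e"
  unfolding spanned_def using indep_subset by (meson insert_mono subsetD)

text \<open>An independent set inside the closure of \<open>I\<close> and as large as
  \<open>I\<close> has the same closure, so whatever \<open>I\<close> leaves unspanned can be added
  to it.\<close>

lemma indep_insert_not_spanned:
  assumes "indep Y" "indep I" "card Y = card I" "\<And>y. y \<in> Y \<Longrightarrow> spanned I y"
    and "\<not> spanned I x"
  shows "indep (insert x Y)"
proof -
  have x: "x \<notin> I" "indep (insert x I)"
    using assms(5) by (auto simp: spanned_def)
  have "card Y < card (insert x I)"
    using x(1) assms(2,3) indep_finite by simp
  then obtain z where z: "z \<in> insert x I - Y" "indep (insert z Y)"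
    using augmentation assms(1) x(2) by blast
  have "z = x"
  proof (rule ccontr)
    assume "z \<noteq> x"
    then have "z \<in> I" using z(1) by blast
    \<comment> \<open>A second augmentation, now of \<open>I\<close>: since \<open>z\<close> is in
      \<open>I\<close>, the new element would come from \<open>Y\<close>, which \<open>I\<close>
      spans.\<close>
    have "card I < card (insert z Y)"
      using z(1) assms(1,3) indep_finite by simp
    then obtain w where "w \<in> insert z Y - I" "indep (insert w I)"
      using augmentation assms(2) z(2) by blast
    with \<open>z \<in> I\<close> assms(4) show False
      by (auto simp: spanned_def)
  qed
  with z(2) show ?thesis by simp
qed

text \<open>The closures of the initial segments of \<open>b\<close> form a flag of flats; the color
  is the index of the first flat containing \<open>e\<close>. Index 0 belongs to the empty
  segment.\<close>

definition flag_color :: "(nat \<Rightarrow> 'a) \<Rightarrow> 'a \<Rightarrow> nat" where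
  "flag_color b e = (LEAST i. spanned (b ` {1..i}) e)"

context
  fixes b :: "nat \<Rightarrow> 'a"
  assumes inj_b: "inj_on b {1..rank}"
    and indep_b: "indep (b ` {1..rank})"
begin

lemma indep_initial: "i \<le> rank \<Longrightarrow> indep (b ` {1..i})"
  using indep_b by (rule indep_subset) auto

lemma card_initial: "i \<le> rank \<Longrightarrow> card (b ` {1..i}) = i"
  using inj_on_subset[OF inj_b] by (subst card_image) auto

text \<open>Otherwise there would be an independent set larger than the rank. Hence the
  \<open>LEAST\<close> in \<open>flag_color\<close> is attained, for every \<open>e\<close>.\<close>

lemma spanned_basis: "spanned (b ` {1..rank}) e"
proof (rule ccontr)
  assume "\<not> ?thesis"
  then have "e \<notin> b ` {1..rank}" and ind: "indep (insert e (b ` {1..rank}))"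
    by (auto simp: spanned_def)
  then have "card (insert e (b ` {1..rank})) = Suc rank"
    using card_initial by simp
  with card_le_rank[OF ind] show False by simp
qed

lemma flag_color_le_rank: "flag_color b e \<le> rank"
  unfolding flag_color_def using spanned_basis by (rule Least_le)

lemma spanned_flag_color: "flag_color b e \<le> i \<Longrightarrow> spanned (b ` {1..i}) e"
proof -
  have "spanned (b ` {1..flag_color b e}) e"
    unfolding flag_color_def using spanned_basis by (rule LeastI)
  then show "flag_color b e \<le> i \<Longrightarrow> ?thesis"
    by (rule spanned_mono) auto
qed

lemma not_spanned_flag_color: "i < flag_color b e \<Longrightarrow> \<not> spanned (b ` {1..i}) e"
  unfolding flag_color_def by (rule not_less_Least)

text \<open>Within \<open>E\<close>, color 0 would mean being spanned by the empty set, that is,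
  being a loop.\<close>

lemma flag_color_pos:
  assumes loopless "e \<in> E"
  shows "0 < flag_color b e"
proof (rule ccontr)
  assume "\<not> ?thesis"
  then have "spanned {} e"
    using spanned_flag_color[of e 0] by simp
  then show False
    using loopless_indep_singleton[OF assms] by (simp add: spanned_def)
qed

text \<open>A basis element is not spanned by earlier ones. Thus every color in
  \<open>{1..rank}\<close> occurs, and \<open>b j\<close> can stand in for color
  \<open>j\<close>.\<close>

lemma flag_color_basis:
  assumes "j \<in> {1..rank}"
  shows "flag_color b (b j) = j"
  unfolding flag_color_def
proof (rule Least_equality)
  show "spanned (b ` {1..j}) (b j)"
    using assms by (auto simp: spanned_def)
next
  fix i
  assume i: "spanned (b ` {1..i}) (b j)"
  show "j \<le> i"
  proof (rule ccontr)
    assume "\<not> j \<le> i"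
    then have "{1..i} \<subseteq> {1..rank}" "j \<notin> {1..i}"
      using assms by auto
    then have "b j \<notin> b ` {1..i}" "insert (b j) (b ` {1..i}) \<subseteq> b ` {1..rank}"
      using assms inj_on_image_mem_iff[OF inj_b] by blast+
    with i indep_b indep_subset show False
      by (auto simp: spanned_def)
  qed
qed

text \<open>The elements chosen for colors up to \<open>i\<close> are as many as \<open>b 1\<close>,
  ..., \<open>b i\<close> and spanned by them, while the element of color \<open>Suc i\<close> is
  not; so it can be added.\<close>

lemma flag_transversal_indep:
  assumes y: "\<And>i. i \<in> {1..rank} \<Longrightarrow> flag_color b (y i) = i"
    and "i \<le> rank"
  shows "indep (y ` {1..i})"
  using assms(2)
proof (induction i)
  case 0
  then show ?case by (simp add: indep_empty)
next
  case (Suc i)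
  have "inj_on y {1..i}"
    \<comment> \<open>The color recovers the index, so \<open>flag_color b\<close> is a left inverse
      of \<open>y\<close>.\<close>
    by (rule inj_on_inverseI[where g = "flag_color b"]) (use y Suc.prems in auto)
  then have "card (y ` {1..i}) = card (b ` {1..i})"
    using Suc.prems card_initial by (simp add: card_image)
  moreover have "spanned (b ` {1..i}) z" if "z \<in> y ` {1..i}" for z
    using that y Suc.prems by (intro spanned_flag_color) auto
  moreover have "\<not> spanned (b ` {1..i}) (y (Suc i))"
    using y Suc.prems by (intro not_spanned_flag_color) auto
  ultimately have "indep (insert (y (Suc i)) (y ` {1..i}))"
    using Suc indep_initial by (intro indep_insert_not_spanned[of _ "b ` {1..i}"]) auto
  then show ?case by (simp add: atLeastAtMostSuc_conv)
qed

lemma flag_rainbow_indep: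
  assumes loopless "X \<subseteq> E" "inj_on (flag_color b) X"
  shows "indep X"
proof -
  \<comment> \<open>\<open>X\<close> is completed to a transversal of all colors, with
    \<open>b i\<close> as default for a color missing from \<open>X\<close>.\<close>
  define y where
    "y i = (if i \<in> flag_color b ` X then inv_into X (flag_color b) i else b i)" for i
  have "flag_color b (y i) = i" if "i \<in> {1..rank}" for i
    using that flag_color_basis by (simp add: y_def f_inv_into_f)
  then have "indep (y ` {1..rank})"
    using flag_transversal_indep by blast
  moreover have "x \<in> y ` {1..rank}" if "x \<in> X" for x
  proof (rule image_eqI)
    show "x = y (flag_color b x)"
      using that assms(3) by (simp add: y_def)
    have "0 < flag_color b x"
      using flag_color_pos assms(1,2) that by blast
    then show "flag_color b x \<in> {1..rank}"
      using flag_color_le_rank[of x] by simp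
  qed
  ultimately show ?thesis
    using indep_subset by blast
qed

lemma flag_color_gallai:
  assumes loopless
  shows "gallai_coloring {1..rank} (flag_color b)"
  unfolding gallai_coloring_def
proof (intro conjI allI impI)
  show "flag_color b \<in> E \<rightarrow> {1..rank}"
    using flag_color_pos[OF assms] flag_color_le_rank by (auto simp: Suc_le_eq)
next
  fix X
  assume X: "circuit X"
  then have fin: "finite X"
    using finite_ground finite_subset by (auto simp: circuit_def)
  \<comment> \<open>A circuit is dependent, so it cannot be rainbow.\<close>
  have "\<not> inj_on (flag_color b) X"
    using X flag_rainbow_indep[OF assms] by (auto simp: circuit_def)
  then have "card (flag_color b ` X) \<noteq> card X"
    using fin eq_card_imp_inj_on by blast
  then show "card (flag_color b ` X) < card X"
    using fin card_image_le[of X "flag_color b"] by simp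
qed

lemma flag_color_image:
  assumes loopless
  shows "flag_color b ` E = {1..rank}"
proof
  show "flag_color b ` E \<subseteq> {1..rank}"
    using flag_color_gallai[OF assms] by (auto simp: gallai_coloring_def)
  show "{1..rank} \<subseteq> flag_color b ` E"
  proof
    fix j
    assume "j \<in> {1..rank}"
    then show "j \<in> flag_color b ` E"
      using flag_color_basis indep_subset_ground[OF indep_b] by (intro image_eqI[of _ _ "b j"]) auto
  qed
qed

end

section \<open>The rank is attained and is the maximum\<close>

lemma rank_in_gallai_counts:
  assumes loopless
  shows "rank \<in> gallai_counts"
proof -
  obtain B where B: "indep B" "card B = rank"
    by (rule obtain_basis)
  \<comment> \<open>Any enumeration of a basis gives a flag and thus a coloring.\<close>
  then obtain b where "bij_betw b {1..rank} B"
    using ex_bij_betw_nat_finite_1[of B] indep_finite by auto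
  with B have "inj_on b {1..rank}" "indep (b ` {1..rank})"
    by (auto simp: bij_betw_def)
  then have "gallai_coloring {1..rank} (flag_color b)" "flag_color b ` E = {1..rank}"
    using assms by (rule flag_color_gallai, rule flag_color_image)
  then show ?thesis
    by (auto simp: gallai_counts_def uses_exactly_def intro!: exI[of _ "flag_color b"])
qed

lemma gallai_number_eq_rank:
  assumes loopless
  shows "gallai_number = rank"
  unfolding gallai_number_def
proof (rule Max_eqI[OF finite_gallai_counts])
  show "k \<le> rank" if "k \<in> gallai_counts" for k
    using that gallai_colors_le_rank by (auto simp: gallai_counts_def uses_exactly_def)
qed (rule rank_in_gallai_counts[OF assms])

end

theorem theorem1p8:
  fixes E :: "'a set" and indep :: "'a set \<Rightarrow> bool"
  assumes "matroid E indep"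
    and "matroid.loopless E indep"
  shows "matroid.gallai_number E indep = matroid.rank E indep"
  using assms by (rule matroid.gallai_number_eq_rank)

end
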